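(* For any $\sigma\in(0,1)$ there exists $\delta_0=\delta_0(\sigma)>0$ such that for any $P\in\mathbb{S}^n$ with $\Vert P-P^*\Vert_F<\delta_0$: the matrix $\mathscr{R}(P)$ is invertible, $\mathcal{A}(\mathscr{K}(P))$ is stable, and $$\Vert P^+-P^*\Vert_F\le\sigma\Vert P-P^*\Vert_F,\qquad\text{where } P^+=\mathcal{L}^{-1}_{\mathcal{A}(\mathscr{K}(P))}\left(-S-\mathscr{K}(P)^TR\mathscr{K}(P)\right)$$ is the next iterate of exact policy iteration from $P$.
   Context: $\mathbb{S}^n$ is the set of real symmetric $n\times n$ matrices, $\Vert\cdot\Vert_F$ the Frobenius norm. $A\in\mathbb{R}^{n\times n}$, $B\in\mathbb{R}^{n\times m}$ with $(A,B)$ controllable; $S\in\mathbb{S}^n$ is positive semidefinite with $(A,S^{1/2})$ observable; $R\in\mathbb{S}^m$ is positive definite. A square matrix is stable if its spectral radius is $<1$. $P^*$ is the unique positive definite solution of $$A^TPA-P-A^TPB(R+B^TPB)^{-1}B^TPA+S=0.$$ For $X,Y\in\mathbb{R}^{n\times n}$: $\mathcal{L}_X(Y)=X^TYX-Y$ (an invertible linear operator on $\mathbb{R}^{n\times n}$ when $X$ is stable); $\mathscr{R}(Y)=R+B^TYB$; $\mathscr{K}(Y)=\mathscr{R}(Y)^{-1}B^TYA$; $\mathcal{A}(\mathscr{K}(Y))=A-B\mathscr{K}(Y)$. *)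

theory Defs
  imports "HOL-Analysis.Analysis"
begin

definition symmetric_mat :: "real^'n^'n \<Rightarrow> bool" where
  "symmetric_mat M \<longleftrightarrow> transpose M = M"

definition pos_semidef :: "real^'n^'n \<Rightarrow> bool" where
  "pos_semidef M \<longleftrightarrow> symmetric_mat M \<and> (\<forall>x. x \<bullet> (M *v x) \<ge> 0)"

definition pos_def :: "real^'n^'n \<Rightarrow> bool" where
  "pos_def M \<longleftrightarrow> symmetric_mat M \<and> (\<forall>x. x \<noteq> 0 \<longrightarrow> x \<bullet> (M *v x) > 0)"

text \<open>\<open>is_psd_sqrt Q S\<close> characterises \<open>Q = S\<^sup>1\<^sup>/\<^sup>2\<close>, the positive semidefinite square root
  of \<open>S\<close>, which exists and is unique for every positive semidefinite \<open>S\<close>.\<close>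

definition is_psd_sqrt :: "real^'n^'n \<Rightarrow> real^'n^'n \<Rightarrow> bool" where
  "is_psd_sqrt Q S \<longleftrightarrow> pos_semidef Q \<and> Q ** Q = S"

text \<open>The power operation of the type class acts entrywise on \<open>real^'n^'n\<close>, hence the need for
  powers with respect to \<open>**\<close>.\<close>

primrec matpow :: "real^'n^'n \<Rightarrow> nat \<Rightarrow> real^'n^'n" where
  "matpow A 0 = mat 1"
| "matpow A (Suc k) = A ** matpow A k"

text \<open>Kalman rank conditions: \<open>[B, A B, \<dots>, A\<^sup>n\<^sup>-\<^sup>1 B]\<close> has (column) rank \<open>n\<close>, respectively
  the matrix with the row blocks \<open>C, C A, \<dots>, C A\<^sup>n\<^sup>-\<^sup>1\<close> has (row) rank \<open>n\<close>.\<close>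

definition controllable :: "real^'n^'n \<Rightarrow> real^'m^'n \<Rightarrow> bool" where
  "controllable (A::real^'n^'n) B \<longleftrightarrow>
     dim (\<Union>k<CARD('n). columns (matpow A k ** B)) = CARD('n)"

definition observable :: "real^'n^'n \<Rightarrow> real^'n^'p \<Rightarrow> bool" where
  "observable (A::real^'n^'n) C \<longleftrightarrow>
     dim (\<Union>k<CARD('n). rows (C ** matpow A k)) = CARD('n)"

text \<open>Eigenvalues of a real matrix are taken over the complex numbers.\<close>

definition spectrum :: "real^'n^'n \<Rightarrow> complex set" where
  "spectrum X = {z. \<exists>v::complex^'n. v \<noteq> 0 \<and> map_matrix complex_of_real X *v v = z *s v}"

definition spectral_radius :: "real^'n^'n \<Rightarrow> real" where
  "spectral_radius X = Max (cmod ` spectrum X)"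

definition stable_mat :: "real^'n^'n \<Rightarrow> bool" where
  "stable_mat X \<longleftrightarrow> spectral_radius X < 1"

definition lyap :: "real^'n^'n \<Rightarrow> real^'n^'n \<Rightarrow> real^'n^'n" where
  "lyap X Y = transpose X ** Y ** X - Y"

definition Rop :: "real^'m^'n \<Rightarrow> real^'m^'m \<Rightarrow> real^'n^'n \<Rightarrow> real^'m^'m" where
  "Rop B R Y = R + transpose B ** Y ** B"

definition gain :: "real^'n^'n \<Rightarrow> real^'m^'n \<Rightarrow> real^'m^'m \<Rightarrow> real^'n^'n \<Rightarrow> real^'n^'m" where
  "gain A B R Y = matrix_inv (Rop B R Y) ** transpose B ** Y ** A"

definition closed_loop :: "real^'n^'n \<Rightarrow> real^'m^'n \<Rightarrow> real^'n^'m \<Rightarrow> real^'n^'n" where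
  "closed_loop A B K = A - B ** K"

definition riccati_solution ::
    "real^'n^'n \<Rightarrow> real^'m^'n \<Rightarrow> real^'n^'n \<Rightarrow> real^'m^'m \<Rightarrow> real^'n^'n \<Rightarrow> bool" where
  "riccati_solution A B S R P \<longleftrightarrow>
     transpose A ** P ** A - P
       - transpose A ** P ** B ** matrix_inv (R + transpose B ** P ** B) ** transpose B ** P ** A
       + S = 0"

text \<open>The operator \<open>lyap X\<close> is a bijection when \<open>X\<close> is stable; \<open>inv\<close> is then its inverse.\<close>

definition policy_iterate ::
    "real^'n^'n \<Rightarrow> real^'m^'n \<Rightarrow> real^'n^'n \<Rightarrow> real^'m^'m \<Rightarrow> real^'n^'n \<Rightarrow> real^'n^'n" where
  "policy_iterate A B S R P =
     (let K = gain A B R P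
      in inv (lyap (closed_loop A B K)) (- S - transpose K ** R ** K))"

text \<open>The norm of the type \<open>real^'n^'m\<close> is the Frobenius norm.\<close>

lemma norm_eq_frobenius:
  fixes M :: "real^'n^'m"
  shows "norm M = sqrt (\<Sum>i\<in>UNIV. \<Sum>j\<in>UNIV. (M $ i $ j)\<^sup>2)"
  by (simp add: norm_vec_def L2_set_def sum_nonneg)

end

theory Submission
  imports Defs "HOL-Computational_Algebra.Fundamental_Theorem_Algebra"
begin

text \<open>
  Policy iteration is Newton's method for the Riccati equation, so its error is quadratic near the
  solution \<open>P\<^sup>*\<close>, and a quadratic error beats any linear rate \<open>\<sigma>\<close> in a small enough ball. Write
  \<open>K\<close>, \<open>K\<^sup>*\<close> for the gains of \<open>P\<close>, \<open>P\<^sup>*\<close>, put \<open>X = A - B K\<close>, \<open>X\<^sup>* = A - B K\<^sup>*\<close>,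
  \<open>G = R + B\<^sup>T P\<^sup>* B\<close>, \<open>D = K - K\<^sup>*\<close>, and let \<open>P\<^sup>+\<close> be the next iterate. Three facts carry the
  proof.

  First, subtracting the defining equations of the two gains gives
  \<open>D = G\<^sup>-\<^sup>1 B\<^sup>T (P - P\<^sup>*) X\<close> (\<open>gain_diff\<close>), hence \<open>D = O(P - P\<^sup>*)\<close> (\<open>gain_lipschitz\<close>).

  Second, the cost of one step, \<open>(A - B K)\<^sup>T P\<^sup>* (A - B K) + K\<^sup>T R K\<close>, is a quadratic function of the
  gain with Hessian \<open>G\<close>, stationary at \<open>K\<^sup>*\<close>. Completing the square (\<open>lyap_gain_residual\<close>) and
  subtracting the equation that defines \<open>P\<^sup>+\<close> leaves
  \<open>X\<^sup>T (P\<^sup>+ - P\<^sup>*) X - (P\<^sup>+ - P\<^sup>*) = - D\<^sup>T G D\<close>, which is of second order in \<open>P - P\<^sup>*\<close>.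

  Third, the Lyapunov operator of \<open>X\<close> has to be inverted with a bound that is uniform for \<open>P\<close> near
  \<open>P\<^sup>*\<close>. The condition used for this is that some fixed power satisfies
  \<open>\<parallel>X\<^sup>N\<parallel>\<^sup>2 \<le> 1/2\<close>: telescoping \<open>N\<close> steps of the Lyapunov equation bounds the inverse
  (\<open>norm_le_lyap\<close>), the condition implies spectral stability (\<open>stable_mat_if_power_small\<close>), and, being
  a strict inequality at \<open>X\<^sup>*\<close>, it persists under small perturbations. That it holds at
  \<open>X\<^sup>*\<close> (\<open>closed_loop_power_small\<close>) is where observability enters: \<open>x \<bullet> P\<^sup>* x\<close> never increases
  along the closed loop, and if it stays constant for \<open>n\<close> steps then the trajectory is uncontrolled
  and unobserved, so \<open>x = 0\<close>.
\<close>

section \<open>The Frobenius norm\<close>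

lemma norm_transpose:
  fixes M :: "'a::real_normed_field^'n^'m"
  shows "norm (transpose M) = norm M"
proof -
  have "(\<Sum>i\<in>UNIV. \<Sum>j\<in>UNIV. (norm (M $ j $ i))\<^sup>2) = (\<Sum>i\<in>UNIV. \<Sum>j\<in>UNIV. (norm (M $ i $ j))\<^sup>2)"
    by (rule sum.swap)
  then show ?thesis
    by (simp add: norm_vec_def L2_set_def sum_nonneg transpose_def)
qed

text \<open>Stated over any normed field because the spectrum of a real matrix is tested on complex
  vectors.\<close>

lemma norm_matrix_vector_mult_le:
  fixes M :: "'a::real_normed_field^'n^'m"
  shows "norm (M *v v) \<le> norm M * norm v"
proof -
  have row: "norm ((M *v v) $ i) \<le> norm (M $ i) * norm v" for i
  proof -
    have "norm ((M *v v) $ i) \<le> (\<Sum>j\<in>UNIV. norm (M $ i $ j * v $ j))"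
      by (simp add: matrix_vector_mult_def norm_sum)
    also have "\<dots> = (\<Sum>j\<in>UNIV. \<bar>norm (M $ i $ j)\<bar> * \<bar>norm (v $ j)\<bar>)"
      by (simp add: norm_mult)
    also have "\<dots> \<le> norm (M $ i) * norm v"
      unfolding norm_vec_def by (rule L2_set_mult_ineq)
    finally show ?thesis .
  qed
  have "norm (M *v v) \<le> L2_set (\<lambda>i. norm (M $ i) * norm v) UNIV"
    unfolding norm_vec_def[of "M *v v"] by (rule L2_set_mono) (use row in auto)
  also have "\<dots> = norm M * norm v"
    by (simp add: norm_vec_def[of M] L2_set_left_distrib)
  finally show ?thesis .
qed

lemma norm_matrix_mult_le:
  fixes M :: "'a::real_normed_field^'n^'m" and N :: "'a^'p^'n"
  shows "norm (M ** N) \<le> norm M * norm N"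
proof -
  have row: "norm ((M ** N) $ i) \<le> norm (M $ i) * norm N" for i
  proof -
    have "(M ** N) $ i = transpose N *v (M $ i)"
      by (simp add: matrix_matrix_mult_def matrix_vector_mult_def transpose_def vec_eq_iff
          vector_matrix_mult_def mult.commute)
    then show ?thesis
      using norm_matrix_vector_mult_le[of "transpose N" "M $ i"]
      by (simp only: norm_transpose mult.commute)
  qed
  have "norm (M ** N) \<le> L2_set (\<lambda>i. norm (M $ i) * norm N) UNIV"
    unfolding norm_vec_def[of "M ** N"] by (rule L2_set_mono) (use row in auto)
  also have "\<dots> = norm M * norm N"
    by (simp add: norm_vec_def[of M] L2_set_left_distrib)
  finally show ?thesis .
qed

interpretation matrix_mult: bounded_bilinear
  "(**) :: real^'n^'m \<Rightarrow> real^'p^'n \<Rightarrow> real^'p^'m"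
proof
  show "\<exists>K. \<forall>(M::real^'n^'m) (N::real^'p^'n). norm (M ** N) \<le> norm M * norm N * K"
    by (rule exI[of _ 1]) (simp add: norm_matrix_mult_le)
qed (simp_all add: matrix_add_ldistrib matrix_matrix_mult_def vec_eq_iff sum.distrib
      algebra_simps sum_distrib_left)

lemma transpose_add: "transpose (M + N) = transpose M + transpose N"
  and transpose_diff: "transpose (M - N) = transpose M - transpose (N :: real^'n^'m)"
  by (simp_all add: transpose_def vec_eq_iff)

lemmas matrix_ring_simps =
  matrix_mult.add_left matrix_mult.add_right matrix_mult.diff_left matrix_mult.diff_right
  matrix_mult.minus_left matrix_mult.minus_right matrix_mul_assoc
  matrix_transpose_mul transpose_add transpose_diff

lemma norm_matrix_mult3_le:
  fixes L :: "'a::real_normed_field^'n^'m" and M :: "'a^'p^'n" and N :: "'a^'q^'p"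
  shows "norm (L ** M ** N) \<le> norm L * norm M * norm N"
  by (rule order_trans[OF norm_matrix_mult_le mult_right_mono[OF norm_matrix_mult_le]]) simp

lemma norm_congruence_le:
  fixes M :: "real^'n^'m" and Y :: "real^'m^'m"
  shows "norm (transpose M ** Y ** M) \<le> (norm M)\<^sup>2 * norm Y"
  using norm_matrix_mult3_le[of "transpose M" Y M]
  by (simp add: norm_transpose power2_eq_square mult_ac)

lemma inner_congruence:
  fixes M :: "real^'n^'m" and Y :: "real^'m^'m"
  shows "x \<bullet> ((transpose M ** Y ** M) *v x) = (M *v x) \<bullet> (Y *v (M *v x))"
  by (metis dot_lmul_matrix inner_commute matrix_vector_mul_assoc transpose_matrix_vector)

section \<open>Matrix powers\<close>

lemma matpow_matpow: "matpow (matpow X n) k = matpow X (n * k)"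
proof -
  have add: "matpow X (i + j) = matpow X i ** matpow X j" for i j
    by (induction i) (simp_all add: matrix_mul_assoc)
  show ?thesis by (induction k) (simp_all add: add)
qed

lemma tendsto_matpow:
  fixes f :: "'a \<Rightarrow> real^'n^'n"
  assumes "(f \<longlongrightarrow> X) F"
  shows "((\<lambda>x. matpow (f x) k) \<longlongrightarrow> matpow X k) F"
  by (induction k) (auto intro!: matrix_mult.tendsto assms)

section \<open>Stability and small powers\<close>

text \<open>The spectral radius is a \<open>Max\<close>, whose value is meaningful only on finite nonempty sets; the
  following two lemmas supply this.\<close>

lemma spectrum_iff_det:
  fixes X :: "real^'a^'a"
  shows   "z \<in> spectrum X \<longleftrightarrow> det (map_matrix complex_of_real X - mat z) = 0"
proof -
  let ?M = "map_matrix complex_of_real X - mat z"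
  have "mat z *v v = z *s v" for v :: "complex^'a"
    by (simp add: vec_eq_iff mat_def matrix_vector_mult_def if_distrib if_distribR cong: if_cong)
  then have "z \<in> spectrum X \<longleftrightarrow> (\<exists>v. v \<noteq> 0 \<and> ?M *v v = 0)"
    by (simp add: spectrum_def matrix_vector_mult_diff_rdistrib)
  also have "\<dots> \<longleftrightarrow> \<not> invertible ?M"
    by (auto simp: invertible_left_inverse matrix_left_invertible_ker)
  also have "\<dots> \<longleftrightarrow> det ?M = 0"
    by (simp add: invertible_det_nz)
  finally show ?thesis .
qed

text \<open>The characteristic polynomial is not constant: \<open>det (w X - 1) = w\<^sup>n det (X - 1/w)\<close> for
  \<open>w \<noteq> 0\<close>, so if \<open>det (X - z)\<close> were constant, the right-hand side would vanish as \<open>w\<close> tends to \<open>0\<close>,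
  while the left-hand side tends to \<open>\<plusminus>1\<close>. Its roots are thus finite in number, and there is one.\<close>

lemma spectrum_finite_nonempty:
  fixes X :: "real^'a^'a"
  shows "finite (spectrum X)" "spectrum X \<noteq> {}"
proof -
  let ?C = "map_matrix complex_of_real X"
  define p :: "complex poly" where "p = det (\<chi> i j. [:?C $ i $ j:] - (if i = j then [:0, 1:] else 0))"
  have poly_p: "poly p z = det (?C - mat z)" for z
    unfolding p_def det_def
    by (simp add: poly_sum poly_prod mat_def if_distrib if_distribR cong: if_cong)
  have spectrum_eq: "spectrum X = {z. poly p z = 0}"
    by (auto simp: spectrum_iff_det poly_p)
  have not_const: "\<not> (\<forall>z. poly p z = c)" for c
  proof
    assume const: "\<forall>z. poly p z = c"
    have det_mat: "det (mat w :: complex^'a^'a) = w ^ CARD('a)" for w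
      by (subst det_diagonal) (simp_all add: mat_def)
    have mat_mult: "mat w ** M = (\<chi> i j. w * M $ i $ j)" for w and M :: "complex^'a^'a"
      by (simp add: vec_eq_iff mat_def matrix_matrix_mult_def if_distrib if_distribR cong: if_cong)
    have eq: "det (mat w ** ?C - mat 1) = w ^ CARD('a) * c" if "w \<noteq> 0" for w
    proof -
      have "mat w ** ?C - mat 1 = mat w ** (?C - mat (1 / w))"
        unfolding mat_mult using that by (simp add: vec_eq_iff mat_def right_diff_distrib)
      then show ?thesis
        using const by (simp add: det_mul det_mat poly_p)
    qed
    have "continuous_on UNIV (\<lambda>w. det (mat w ** ?C - mat 1))"
      unfolding det_def mat_mult by (auto intro!: continuous_intros)
    then have "isCont (\<lambda>w. det (mat w ** ?C - mat 1)) 0"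
      by (simp add: continuous_on_eq_continuous_at)
    then have "(\<lambda>w. det (mat w ** ?C - mat 1)) \<midarrow>0\<rightarrow> det (mat 0 ** ?C - mat 1)"
      by (rule isContD)
    moreover have "mat 0 ** ?C - mat 1 = (mat (- 1) :: complex^'a^'a)"
      unfolding mat_mult by (simp add: vec_eq_iff mat_def)
    ultimately have "(\<lambda>w. det (mat w ** ?C - mat 1)) \<midarrow>0\<rightarrow> (- 1) ^ CARD('a)"
      by (simp add: det_mat)
    then have "(\<lambda>w. w ^ CARD('a) * c) \<midarrow>0\<rightarrow> (- 1) ^ CARD('a)"
      by (rule Lim_transform_eventually) (auto simp: eventually_at_filter eq)
    moreover have "(\<lambda>w. w ^ CARD('a) * c) \<midarrow>0\<rightarrow> 0 ^ CARD('a) * c"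
      by (intro tendsto_intros)
    ultimately have "(- 1) ^ CARD('a) = 0 ^ CARD('a) * c"
      by (rule LIM_unique)
    then show False by (simp add: power_0_left)
  qed
  show "finite (spectrum X)"
    unfolding spectrum_eq using not_const[of 0] by (intro poly_roots_finite) auto
  have "\<not> constant (poly p)"
    using not_const[of "poly p 0"] by (auto simp: constant_def)
  then show "spectrum X \<noteq> {}"
    unfolding spectrum_eq using fundamental_theorem_of_algebra[of p] by blast
qed

text \<open>An eigenvalue \<open>z\<close> of \<open>X\<close> gives the eigenvalue \<open>z\<^sup>N\<close> of \<open>X\<^sup>N\<close>, which the norm bounds.\<close>

lemma stable_mat_if_power_small:
  fixes X :: "real^'a^'a"
  assumes "norm (matpow X N) < 1"
  shows "stable_mat X"
proof -
  let ?c = "map_matrix complex_of_real :: real^'a^'a \<Rightarrow> complex^'a^'a"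
  have map_mult: "?c (Y ** Z) = ?c Y ** ?c Z" for Y Z
    by (simp add: vec_eq_iff map_matrix_def matrix_matrix_mult_def)
  have "cmod z < 1" if "z \<in> spectrum X" for z
  proof -
    from that obtain v where v: "v \<noteq> 0" "?c X *v v = z *s v"
      by (auto simp: spectrum_def)
    have pow: "?c (matpow X k) *v v = z ^ k *s v" for k
    proof (induction k)
      case 0
      have "?c (mat 1) = mat 1" by (simp add: vec_eq_iff mat_def map_matrix_def)
      then show ?case by simp
    next
      case (Suc k)
      then show ?case
        by (simp add: map_mult matrix_vector_mul_assoc[symmetric] vector_scalar_commute v mult_ac)
    qed
    have "norm (?c (matpow X N)) = norm (matpow X N)"
      by (simp add: norm_vec_def map_matrix_def)
    then have "norm (z ^ N *s v) \<le> norm (matpow X N) * norm v"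
      using norm_matrix_vector_mult_le[of "?c (matpow X N)" v] by (simp add: pow)
    moreover have "norm (z ^ N *s v) = cmod z ^ N * norm v"
      by (simp add: norm_vec_def norm_mult norm_power L2_set_right_distrib)
    ultimately have "cmod z ^ N < 1"
      using v assms by simp
    then show ?thesis
      using one_le_power[of "cmod z" N] by linarith
  qed
  then show ?thesis
    unfolding stable_mat_def spectral_radius_def
    using spectrum_finite_nonempty[of X] by simp
qed

section \<open>The Lyapunov operator\<close>

lemma linear_lyap: "linear (lyap X)"
  by unfold_locales
    (simp_all add: lyap_def matrix_ring_simps matrix_mult.scaleR_left matrix_mult.scaleR_right algebra_simps)

text \<open>Iterating \<open>D = X\<^sup>T D X - lyap X D\<close> for \<open>N\<close> steps leaves the remainder \<open>(X\<^sup>N)\<^sup>T D X\<^sup>N\<close>, at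
  most half of \<open>D\<close>, which the left-hand side absorbs. The constant depends continuously on \<open>X\<close>, so
  it is uniform on a neighbourhood.\<close>

lemma norm_le_lyap:
  assumes "(norm (matpow X N))\<^sup>2 \<le> 1 / 2"
  shows "norm D \<le> 2 * (\<Sum>k<N. (norm (matpow X k))\<^sup>2) * norm (lyap X D)"
proof -
  let ?L = "lyap X D"
  have telescope: "transpose (matpow X k) ** D ** matpow X k
      = D + (\<Sum>j<k. transpose (matpow X j) ** ?L ** matpow X j)" for k
  proof (induction k)
    case (Suc k)
    have "transpose (matpow X (Suc k)) ** D ** matpow X (Suc k)
        = transpose (matpow X k) ** (transpose X ** D ** X) ** matpow X k"
      by (simp add: matrix_ring_simps)
    also have "transpose X ** D ** X = D + ?L"
      by (simp add: lyap_def)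
    also have "transpose (matpow X k) ** (D + ?L) ** matpow X k
        = transpose (matpow X k) ** D ** matpow X k + transpose (matpow X k) ** ?L ** matpow X k"
      by (simp only: matrix_mult.add_left matrix_mult.add_right)
    finally show ?case
      unfolding Suc by (simp add: add.assoc)
  qed simp
  have "norm D \<le> norm (transpose (matpow X N) ** D ** matpow X N)
                 + norm (\<Sum>j<N. transpose (matpow X j) ** ?L ** matpow X j)"
    using norm_triangle_ineq4[of "transpose (matpow X N) ** D ** matpow X N"
        "\<Sum>j<N. transpose (matpow X j) ** ?L ** matpow X j"]
    by (simp add: telescope)
  also have "\<dots> \<le> 1 / 2 * norm D + (\<Sum>j<N. (norm (matpow X j))\<^sup>2 * norm ?L)"
  proof (rule add_mono)
    show "norm (transpose (matpow X N) ** D ** matpow X N) \<le> 1 / 2 * norm D"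
      using norm_congruence_le[of "matpow X N" D] mult_right_mono[OF assms, of "norm D"] by simp
    show "norm (\<Sum>j<N. transpose (matpow X j) ** ?L ** matpow X j) \<le> (\<Sum>j<N. (norm (matpow X j))\<^sup>2 * norm ?L)"
      by (rule sum_norm_le) (rule norm_congruence_le)
  qed
  finally show ?thesis by (simp add: sum_distrib_right[symmetric])
qed

lemma lyap_inv:
  assumes "(norm (matpow X N))\<^sup>2 \<le> 1 / 2"
  shows "lyap X (inv (lyap X) W) = W"
proof -
  have "D = 0" if "lyap X D = 0" for D
    using norm_le_lyap[OF assms, of D] that by simp
  then have "inj (lyap X)"
    using linear_injective_0[OF linear_lyap] by blast
  then have "surj (lyap X)"
    by (simp add: linear_injective_imp_surjective[OF linear_lyap])
  then show ?thesis by (rule surj_f_inv_f)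
qed

section \<open>Powers of the optimal closed loop\<close>

text \<open>Strict decrease of a quadratic form at every nonzero point is, by homogeneity and compactness of
  the unit sphere, decrease by a uniform factor \<open>r < 1\<close>; the form then decays like \<open>r\<^sup>k\<close>, and it
  dominates a multiple of the squared norm.\<close>

lemma matpow_tendsto_0:
  fixes P :: "real^'n^'n"
  assumes P: "pos_def P"
    and decrease: "\<And>x. x \<noteq> 0 \<Longrightarrow> (M *v x) \<bullet> (P *v (M *v x)) < x \<bullet> (P *v x)"
  shows "matpow M \<longlonglongrightarrow> 0"
proof -
  define V where "V x = x \<bullet> (P *v x)" for x
  have V_pos: "V x > 0" if "x \<noteq> 0" for x
    using P that by (simp add: V_def pos_def_def)
  have V_scale: "V (c *\<^sub>R x) = c\<^sup>2 * V x" for c x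
    by (simp add: V_def matrix_vector_mult_scaleR power2_eq_square)
  have cont: "continuous_on UNIV V"
    unfolding V_def by (intro continuous_intros linear_continuous_on matrix_vector_mul_bounded_linear)
  let ?U = "sphere (0::real^'n) 1"
  have U: "compact ?U" "?U \<noteq> {}" by auto
  have in_U: "x /\<^sub>R norm x \<in> ?U" if "x \<noteq> 0" for x :: "real^'n"
    using that by simp
  have V_normalise: "V (L *v x) = (norm x)\<^sup>2 * V (L *v (x /\<^sub>R norm x))" if "x \<noteq> 0" for L x
  proof -
    have "L *v x = norm x *\<^sub>R (L *v (x /\<^sub>R norm x))"
      using that by (simp add: matrix_vector_mult_scaleR)
    then show ?thesis by (simp only: V_scale)
  qed
  obtain m where m: "m > 0" "\<And>x. m * (norm x)\<^sup>2 \<le> V x"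
  proof -
    from continuous_attains_inf[OF U continuous_on_subset[OF cont]]
    obtain u where u: "u \<in> ?U" "\<And>y. y \<in> ?U \<Longrightarrow> V u \<le> V y" by auto
    have "V u * (norm x)\<^sup>2 \<le> V x" for x
    proof (cases "x = 0")
      case False
      have "V u * (norm x)\<^sup>2 \<le> (norm x)\<^sup>2 * V (x /\<^sub>R norm x)"
        using u(2)[OF in_U[OF False]] by (subst mult.commute) (rule mult_left_mono, simp_all)
      then show ?thesis
        using V_normalise[OF False, of "mat 1"] by simp
    qed (simp add: V_def)
    moreover have "V u > 0" using u(1) by (intro V_pos) auto
    ultimately show ?thesis using that by blast
  qed
  obtain r where r: "0 \<le> r" "r < 1" "\<And>x. V (M *v x) \<le> r * V x"
  proof -
    have "continuous_on ?U (\<lambda>x. V (M *v x) / V x)"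
    proof (intro continuous_on_divide)
      show "continuous_on ?U (\<lambda>x. V (M *v x))"
        by (rule continuous_on_compose2[OF cont])
          (auto intro!: linear_continuous_on matrix_vector_mul_bounded_linear)
      show "continuous_on ?U V" using cont continuous_on_subset by blast
      show "\<forall>x\<in>?U. V x \<noteq> 0" proof
        fix x assume "x \<in> ?U"
        then have "x \<noteq> 0" by auto
        then show "V x \<noteq> 0" using V_pos[of x] by simp
      qed
    qed
    from continuous_attains_sup[OF U this]
    obtain u where u: "u \<in> ?U" "\<And>y. y \<in> ?U \<Longrightarrow> V (M *v y) / V y \<le> V (M *v u) / V u" by auto
    let ?r = "V (M *v u) / V u"
    have "u \<noteq> 0" using u(1) by auto
    have V_nonneg: "V x \<ge> 0" for x using V_pos[of x] by (cases "x = 0") (auto simp: V_def)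
    have "?r < 1" using decrease[OF \<open>u \<noteq> 0\<close>] V_pos[OF \<open>u \<noteq> 0\<close>] by (simp add: V_def)
    moreover have "0 \<le> ?r" by (simp add: V_nonneg)
    moreover have "V (M *v x) \<le> ?r * V x" for x
    proof (cases "x = 0")
      case False
      let ?y = "x /\<^sub>R norm x"
      have y: "?y \<noteq> 0" using False by simp
      have "V (M *v ?y) \<le> ?r * V ?y"
        using u(2)[OF in_U[OF False]] V_pos[OF y] by (simp only: pos_divide_le_eq)
      then have "(norm x)\<^sup>2 * V (M *v ?y) \<le> (norm x)\<^sup>2 * (?r * V ?y)"
        by (rule mult_left_mono) simp
      then have "(norm x)\<^sup>2 * V (M *v ?y) \<le> ?r * ((norm x)\<^sup>2 * V ?y)"
        by (simp only: mult.left_commute)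
      then show ?thesis
        using V_normalise[OF False, of M] V_normalise[OF False, of "mat 1"] by simp
    qed (simp add: V_def)
    ultimately show ?thesis using that by blast
  qed
  have V_pow: "V (matpow M k *v x) \<le> r ^ k * V x" for k x
  proof (induction k)
    case (Suc k)
    have "V (matpow M (Suc k) *v x) \<le> r * V (matpow M k *v x)"
      using r(3)[of "matpow M k *v x"] by (simp add: matrix_vector_mul_assoc)
    also have "\<dots> \<le> r * (r ^ k * V x)" using Suc r(1) by (rule mult_left_mono)
    finally show ?case by simp
  qed simp
  have "(\<lambda>k. matpow M k *v x) \<longlonglongrightarrow> 0" for x
  proof -
    have "(\<lambda>k. r ^ k * V x / m) \<longlonglongrightarrow> 0"
      using LIMSEQ_power_zero[of r] r by (auto intro!: tendsto_divide_zero tendsto_mult_left_zero)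
    then have "(\<lambda>k. (norm (matpow M k *v x))\<^sup>2) \<longlonglongrightarrow> 0"
    proof (rule Lim_null_comparison[rotated], intro always_eventually allI)
      fix k
      have "m * (norm (matpow M k *v x))\<^sup>2 \<le> r ^ k * V x"
        using m(2) V_pow order_trans by blast
      then show "norm ((norm (matpow M k *v x))\<^sup>2) \<le> r ^ k * V x / m"
        using m(1) by (simp add: pos_le_divide_eq mult.commute)
    qed
    from tendsto_real_sqrt[OF this] show ?thesis
      by (simp add: tendsto_norm_zero_iff)
  qed
  then have "(\<lambda>k. (matpow M k *v axis j 1) $ i) \<longlonglongrightarrow> 0" for i j
    using tendsto_vec_nth by fastforce
  then have "(\<lambda>k. matpow M k $ i $ j) \<longlonglongrightarrow> 0" for i j
    by (simp add: matrix_vector_mult_basis column_def)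
  then show ?thesis
    by (intro vec_tendstoI) simp
qed

lemma observable_imp_zero:
  fixes A :: "real^'n^'n"
  assumes "observable A C" and zero: "\<And>k. k < CARD('n) \<Longrightarrow> C *v (matpow A k *v x) = 0"
  shows "x = 0"
proof -
  let ?rows = "\<Union>k<CARD('n). rows (C ** matpow A k)"
  have "orthogonal x r" if "r \<in> ?rows" for r
  proof -
    from that obtain k i where k: "k < CARD('n)" and r: "r = row i (C ** matpow A k)"
      by (auto simp: rows_def)
    have "r \<bullet> x = ((C ** matpow A k) *v x) $ i"
      by (simp add: r row_def matrix_vector_mul_component)
    then show ?thesis
      using zero[OF k] by (simp add: orthogonal_def inner_commute matrix_vector_mul_assoc)
  qed
  moreover have "span ?rows = UNIV"
    using assms(1) dim_eq_full[of ?rows] by (simp add: observable_def)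
  ultimately have "orthogonal x x"
    using orthogonal_to_span[of x ?rows x] by blast
  then show ?thesis by (simp add: orthogonal_self)
qed

text \<open>The form \<open>V x = x \<bullet> P x\<close> drops in each step by \<open>\<parallel>Q x\<parallel>\<^sup>2 + K x \<bullet> R (K x)\<close>. A single drop may
  vanish, but \<open>n\<close> consecutive ones cannot unless \<open>x = 0\<close>: without control action the closed loop
  follows \<open>A\<close>, and \<open>Q A\<^sup>k x = 0\<close> for \<open>k < n\<close> contradicts observability. So the strict decrease
  needed for decaying powers is available for \<open>X\<^sup>n\<close>, rather than for \<open>X\<close> itself.\<close>

lemma closed_loop_power_small:
  fixes A :: "real^'n^'n" and B :: "real^'m^'n" and K :: "real^'n^'m"
  defines "X \<equiv> closed_loop A B K"
  assumes P: "pos_def P" and R: "pos_def R" and Q: "symmetric_mat Q" and obs: "observable A Q"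
    and eq: "lyap X P = - (Q ** Q) - transpose K ** R ** K"
  obtains N where "(norm (matpow X N))\<^sup>2 < 1 / 2"
proof -
  let ?n = "CARD('n)"
  define V where "V x = x \<bullet> (P *v x)" for x
  define q where "q x = (Q *v x) \<bullet> (Q *v x) + (K *v x) \<bullet> (R *v (K *v x))" for x
  have R_nonneg: "y \<bullet> (R *v y) \<ge> 0" for y
    using R by (cases "y = 0") (auto simp: pos_def_def less_imp_le)
  have q_nonneg: "q x \<ge> 0" for x using R_nonneg by (simp add: q_def)
  have q_zero: "Q *v x = 0" "K *v x = 0" if "q x = 0" for x
  proof -
    have "(K *v x) \<bullet> (R *v (K *v x)) = 0"
      using that R_nonneg[of "K *v x"] inner_ge_zero[of "Q *v x"] unfolding q_def by linarith
    then show "K *v x = 0" using R unfolding pos_def_def by (metis less_irrefl)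
    then show "Q *v x = 0" using that by (simp add: q_def)
  qed
  have step: "V (X *v x) = V x - q x" for x
  proof -
    \<comment> \<open>The factor \<open>mat 1\<close> gives every term the shape of a congruence.\<close>
    have "transpose X ** P ** X = P - transpose Q ** mat 1 ** Q - transpose K ** R ** K"
      using eq Q by (simp add: lyap_def symmetric_mat_def algebra_simps)
    then have "x \<bullet> ((transpose X ** P ** X) *v x)
        = x \<bullet> (P *v x) - x \<bullet> ((transpose Q ** mat 1 ** Q) *v x) - x \<bullet> ((transpose K ** R ** K) *v x)"
      by (simp add: matrix_vector_mult_diff_rdistrib inner_diff_right)
    then show ?thesis
      unfolding inner_congruence by (simp add: V_def q_def)
  qed
  have sum: "V (matpow X k *v x) = V x - (\<Sum>j<k. q (matpow X j *v x))" for k x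
  proof (induction k)
    case (Suc k)
    have "V (matpow X (Suc k) *v x) = V (X *v (matpow X k *v x))"
      by (simp add: matrix_vector_mul_assoc)
    then show ?case using Suc step by simp
  qed simp
  have "V (matpow X ?n *v x) < V x" if "x \<noteq> 0" for x
  proof (rule ccontr)
    assume "\<not> ?thesis"
    then have "(\<Sum>j<?n. q (matpow X j *v x)) \<le> 0"
      unfolding sum by simp
    then have "(\<Sum>j<?n. q (matpow X j *v x)) = 0"
      by (intro antisym sum_nonneg q_nonneg)
    then have q0: "q (matpow X j *v x) = 0" if "j < ?n" for j
      using that by (simp add: sum_nonneg_eq_0_iff q_nonneg)
    have same: "matpow X k *v x = matpow A k *v x" if "k \<le> ?n" for k
      using that
    proof (induction k)
      case (Suc k)
      have "X *v y = A *v y - B *v (K *v y)" for y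
        by (simp add: X_def closed_loop_def matrix_vector_mult_diff_rdistrib matrix_vector_mul_assoc)
      then have "X *v (matpow X k *v x) = A *v (matpow X k *v x)"
        using q_zero(2)[OF q0[of k]] Suc.prems by simp
      then show ?case using Suc by (simp add: matrix_vector_mul_assoc[symmetric])
    qed simp
    have "Q *v (matpow A k *v x) = 0" if "k < ?n" for k
      using q_zero(1)[OF q0[OF that]] same[of k] that by simp
    then show False using observable_imp_zero[OF obs] \<open>x \<noteq> 0\<close> by blast
  qed
  then have "matpow (matpow X ?n) \<longlonglongrightarrow> 0"
    unfolding V_def by (intro matpow_tendsto_0[OF P])
  then have "(\<lambda>k. (norm (matpow (matpow X ?n) k))\<^sup>2) \<longlonglongrightarrow> 0"
    by (auto intro!: tendsto_eq_intros)
  then have "\<forall>\<^sub>F k in sequentially. (norm (matpow (matpow X ?n) k))\<^sup>2 < 1 / 2"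
    by (rule order_tendstoD) simp
  then show ?thesis
    using that unfolding matpow_matpow eventually_sequentially by blast
qed

section \<open>Dependence of the gain on the cost matrix\<close>

lemma
  fixes M :: "real^'n^'n"
  assumes "invertible M"
  shows matrix_inv_left: "matrix_inv M ** M = mat 1"
    and matrix_inv_right: "M ** matrix_inv M = mat 1"
  using assms someI_ex[of "\<lambda>N. M ** N = mat 1 \<and> N ** M = mat 1"]
  by (auto simp: invertible_def matrix_inv_def)

lemma Rop_mult_gain:
  assumes "invertible (Rop B R P)"
  shows "Rop B R P ** gain A B R P = transpose B ** P ** A"
  using assms by (simp add: gain_def matrix_mul_assoc matrix_inv_right)

text \<open>A kernel vector \<open>y\<close> of the perturbed matrix satisfies
  \<open>y = - G\<^sup>-\<^sup>1 B\<^sup>T (P - P0) B y\<close> with \<open>G\<close> the unperturbed one, which is a strict contraction.\<close>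

lemma invertible_Rop_near:
  fixes P0 :: "real^'n^'n" and B :: "real^'m^'n"
  assumes inv0: "invertible (Rop B R P0)"
    and small: "norm (matrix_inv (Rop B R P0)) * (norm B)\<^sup>2 * norm (P - P0) < 1"
  shows "invertible (Rop B R P)"
proof -
  let ?G = "Rop B R P0"
  have "y = 0" if "Rop B R P *v y = 0" for y
  proof (rule ccontr)
    assume "y \<noteq> 0"
    let ?E = "transpose B ** (P - P0) ** B"
    have "?G = Rop B R P - ?E"
      by (simp add: Rop_def matrix_ring_simps)
    then have "?G *v y = - (?E *v y)"
      using that by (simp add: matrix_vector_mult_diff_rdistrib)
    then have Gy: "norm (?G *v y) = norm (?E *v y)" by simp
    have "norm y = norm (matrix_inv ?G *v (?G *v y))"
      by (simp add: matrix_vector_mul_assoc matrix_inv_left[OF inv0])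
    also have "\<dots> \<le> norm (matrix_inv ?G) * norm (?E *v y)"
      unfolding Gy[symmetric] by (rule norm_matrix_vector_mult_le)
    also have "\<dots> \<le> norm (matrix_inv ?G) * (norm ?E * norm y)"
      by (intro mult_left_mono norm_matrix_vector_mult_le) simp
    also have "\<dots> \<le> norm (matrix_inv ?G) * (((norm B)\<^sup>2 * norm (P - P0)) * norm y)"
      by (intro mult_left_mono mult_right_mono norm_congruence_le) simp_all
    also have "\<dots> < 1 * norm y"
    proof -
      have "norm (matrix_inv ?G) * (norm B)\<^sup>2 * norm (P - P0) * norm y < 1 * norm y"
        using small \<open>y \<noteq> 0\<close> by (intro mult_strict_right_mono) simp_all
      then show ?thesis by (simp only: mult.assoc)
    qed
    finally show False by simp
  qed
  then show ?thesis
    by (simp add: invertible_left_inverse matrix_left_invertible_ker)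
qed

text \<open>An exact first-order formula: only the inverse at the base point \<open>P0\<close> occurs, so estimates follow
  without studying how the inverse varies with \<open>P\<close>.\<close>

lemma gain_diff:
  assumes inv0: "invertible (Rop B R P0)" and inv: "invertible (Rop B R P)"
  shows "gain A B R P - gain A B R P0
    = matrix_inv (Rop B R P0) ** transpose B ** (P - P0) ** closed_loop A B (gain A B R P)"
proof -
  let ?K = "gain A B R P" and ?G = "Rop B R P0"
  have "?G ** (?K - gain A B R P0) = ?G ** ?K - transpose B ** P0 ** A"
    using Rop_mult_gain[OF inv0] by (simp add: matrix_mult.diff_right)
  also have "?G ** ?K = Rop B R P ** ?K - transpose B ** (P - P0) ** B ** ?K"
    by (simp add: Rop_def matrix_ring_simps)
  also have "\<dots> - transpose B ** P0 ** A = transpose B ** (P - P0) ** closed_loop A B ?K"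
    unfolding Rop_mult_gain[OF inv] by (simp add: closed_loop_def matrix_ring_simps)
  finally have "?G ** (?K - gain A B R P0) = transpose B ** (P - P0) ** closed_loop A B ?K" .
  moreover have "?K - gain A B R P0 = matrix_inv ?G ** (?G ** (?K - gain A B R P0))"
    by (simp only: matrix_mul_assoc matrix_inv_left[OF inv0] matrix_mul_lid)
  ultimately show ?thesis
    by (simp only: matrix_mul_assoc)
qed

text \<open>The closed loop in \<open>gain_diff\<close> itself depends on the gain difference \<open>e\<close>; with \<open>p\<close> the distance
  of \<open>P\<close> from \<open>P0\<close> this reads \<open>e \<le> b p (\<parallel>X\<parallel> + \<parallel>B\<parallel> e)\<close>, where \<open>X\<close> is the closed loop at \<open>P0\<close>
  and \<open>b = \<parallel>G\<^sup>-\<^sup>1\<parallel> \<parallel>B\<parallel>\<close> with \<open>G = R + B\<^sup>T P0 B\<close>. For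
  \<open>b \<parallel>B\<parallel> p \<le> 1/2\<close> the term in \<open>e\<close> on the right is absorbed.\<close>

lemma gain_lipschitz:
  assumes inv0: "invertible (Rop B R P0)"
  obtains c d where "c > 0" "d > 0"
    "\<And>P. norm (P - P0) < d \<Longrightarrow> invertible (Rop B R P) \<and>
        norm (gain A B R P - gain A B R P0) \<le> c * norm (P - P0)"
proof -
  let ?b = "norm (matrix_inv (Rop B R P0)) * norm B"
  let ?X = "closed_loop A B (gain A B R P0)"
  \<comment> \<open>The summand 1 keeps the radius, and below the Lipschitz constant, positive when \<open>B\<close> or the
    closed loop vanishes.\<close>
  let ?d = "1 / (2 * (?b * norm B + 1))"
  have b: "?b \<ge> 0" "?b * norm B \<ge> 0" by simp_all
  have main: "invertible (Rop B R P) \<and>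
    norm (gain A B R P - gain A B R P0) \<le> (2 * ?b * norm ?X + 1) * norm (P - P0)"
    if "norm (P - P0) < ?d" for P
  proof
    define e where "e = norm (gain A B R P - gain A B R P0)"
    define p where "p = norm (P - P0)"
    have p: "p \<ge> 0" by (simp add: p_def)
    have "p * (2 * (?b * norm B + 1)) < 1"
      using that b by (simp add: p_def pos_less_divide_eq)
    then have half: "?b * norm B * p \<le> 1 / 2"
      using p by (simp add: algebra_simps)
    then show inv: "invertible (Rop B R P)"
      by (intro invertible_Rop_near[OF inv0]) (simp add: power2_eq_square mult_ac p_def)
    have "closed_loop A B (gain A B R P) = ?X - B ** (gain A B R P - gain A B R P0)"
      by (simp add: closed_loop_def matrix_ring_simps)
    then have X: "norm (closed_loop A B (gain A B R P)) \<le> norm ?X + norm B * e"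
      unfolding e_def by (auto intro!: order_trans[OF norm_triangle_ineq4] norm_matrix_mult_le)
    have "e \<le> norm (matrix_inv (Rop B R P0) ** transpose B ** (P - P0))
        * norm (closed_loop A B (gain A B R P))"
      unfolding e_def gain_diff[OF inv0 inv] by (rule norm_matrix_mult_le)
    also have "\<dots> \<le> ?b * p * (norm ?X + norm B * e)"
    proof (rule mult_mono[OF _ X])
      show "norm (matrix_inv (Rop B R P0) ** transpose B ** (P - P0)) \<le> ?b * p"
        using norm_matrix_mult3_le[of "matrix_inv (Rop B R P0)" "transpose B" "P - P0"]
        by (simp add: p_def norm_transpose)
    qed (simp_all add: p_def)
    also have "\<dots> = ?b * norm ?X * p + ?b * norm B * p * e" by (simp add: algebra_simps)
    also have "\<dots> \<le> ?b * norm ?X * p + 1 / 2 * e"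
      using mult_right_mono[OF half, of e] by (simp add: e_def)
    finally have "e \<le> 2 * ?b * norm ?X * p" by simp
    then have "e \<le> (2 * ?b * norm ?X + 1) * p"
      using p by (simp add: algebra_simps)
    then show "norm (gain A B R P - gain A B R P0) \<le> (2 * ?b * norm ?X + 1) * norm (P - P0)"
      by (simp add: e_def p_def)
  qed
  show ?thesis
  proof (rule that[OF _ _ main])
    show "2 * ?b * norm ?X + 1 > 0" by (intro add_nonneg_pos) simp_all
    show "?d > 0" using b by (intro divide_pos_pos mult_pos_pos add_nonneg_pos) simp_all
  qed
qed

section \<open>The policy evaluation residual is quadratic in the gain\<close>

text \<open>Completing the square in the gain. The terms linear in \<open>D\<close> cancel because the gain \<open>K0\<close> of \<open>P\<close>
  is stationary, \<open>B\<^sup>T P X = R K0\<close> with \<open>X\<close> its closed loop, and the constant term vanishes by the Riccati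
  equation. At \<open>D = 0\<close> this is the Riccati equation in closed-loop form.\<close>

lemma lyap_gain_residual:
  fixes A :: "real^'n^'n" and B :: "real^'m^'n" and K :: "real^'n^'m"
  assumes P: "symmetric_mat P" and R: "symmetric_mat R" and inv: "invertible (Rop B R P)"
    and ric: "riccati_solution A B S R P"
  defines "D \<equiv> K - gain A B R P"
  shows "lyap (closed_loop A B K) P
    = - S - transpose K ** R ** K + transpose D ** Rop B R P ** D"
proof -
  define K0 where "K0 = gain A B R P"
  define X where "X = closed_loop A B K0"
  have PR: "transpose P = P" "transpose R = R" using P R by (simp_all add: symmetric_mat_def)
  \<comment> \<open>Stationarity of the one-step cost at the gain of \<open>P\<close>.\<close>
  have stat: "transpose B ** P ** X = R ** K0"
    using Rop_mult_gain[OF inv, of A]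
    by (simp add: X_def K0_def closed_loop_def Rop_def matrix_ring_simps algebra_simps)
  then have stat': "transpose X ** P ** B = transpose K0 ** R"
    by (metis PR matrix_mul_assoc matrix_transpose_mul transpose_transpose)
  have "transpose A ** P ** X = P - S"
    using ric unfolding riccati_solution_def X_def K0_def closed_loop_def gain_def Rop_def
    by (simp add: matrix_ring_simps algebra_simps)
  moreover have "transpose A = transpose X + transpose K0 ** transpose B"
    by (simp add: X_def closed_loop_def matrix_ring_simps)
  ultimately have "P - S = transpose X ** P ** X + transpose K0 ** (transpose B ** P ** X)"
    by (simp add: matrix_ring_simps)
  then have opt: "transpose X ** P ** X = P - S - transpose K0 ** R ** K0"
    unfolding stat by (simp add: matrix_mul_assoc)
  have K: "K = K0 + D" by (simp add: D_def K0_def)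
  have shift: "closed_loop A B K = X - B ** D"
    by (simp add: K X_def closed_loop_def matrix_ring_simps)
  have "lyap (closed_loop A B K) P = transpose X ** P ** X - transpose X ** P ** B ** D
      - transpose D ** (transpose B ** P ** X) + transpose D ** transpose B ** P ** B ** D - P"
    by (simp add: lyap_def shift matrix_ring_simps)
  then show ?thesis
    unfolding stat stat' opt by (simp add: K Rop_def matrix_ring_simps algebra_simps)
qed

section \<open>Local contraction of policy iteration\<close>

lemma invertible_pos_def:
  assumes "pos_def M"
  shows "invertible M"
proof -
  have "x = 0" if "M *v x = 0" for x
    using assms that by (metis inner_zero_right less_irrefl pos_def_def)
  then show ?thesis by (simp add: invertible_left_inverse matrix_left_invertible_ker)
qed

lemma pos_def_Rop:
  assumes R: "pos_def R" and P: "pos_def P"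
  shows "pos_def (Rop B R P)"
  unfolding pos_def_def symmetric_mat_def
proof (intro conjI allI impI)
  show "transpose (Rop B R P) = Rop B R P"
    using R P by (simp add: pos_def_def symmetric_mat_def Rop_def matrix_ring_simps)
  fix x :: "real^'a" assume "x \<noteq> 0"
  then have "x \<bullet> (R *v x) > 0" using R by (simp add: pos_def_def)
  moreover have "(B *v x) \<bullet> (P *v (B *v x)) \<ge> 0"
    using P by (cases "B *v x = 0") (auto simp: pos_def_def less_imp_le)
  ultimately show "x \<bullet> (Rop B R P *v x) > 0"
    by (simp add: Rop_def matrix_vector_mult_add_rdistrib inner_add_right inner_congruence)
qed

theorem lemma1:
  fixes A S Pstar Shalf :: "real^'n^'n"
    and B :: "real^'m^'n"
    and R :: "real^'m^'m"
    and \<sigma> :: real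
  assumes "controllable A B"
    and "pos_semidef S"
    and "is_psd_sqrt Shalf S"
    and "observable A Shalf"
    and "pos_def R"
    and "pos_def Pstar"
    and "riccati_solution A B S R Pstar"
    and "0 < \<sigma>" and "\<sigma> < 1"
  shows "\<exists>\<delta>\<^sub>0>0. \<forall>P. symmetric_mat P \<and> norm (P - Pstar) < \<delta>\<^sub>0 \<longrightarrow>
           invertible (Rop B R P) \<and>
           stable_mat (closed_loop A B (gain A B R P)) \<and>
           norm (policy_iterate A B S R P - Pstar) \<le> \<sigma> * norm (P - Pstar)"
proof -
  let ?G = "Rop B R Pstar"
  let ?K = "gain A B R" and ?X = "\<lambda>P. closed_loop A B (gain A B R P)"
  have sym: "symmetric_mat Pstar" "symmetric_mat R" "symmetric_mat Shalf"
    and Shalf: "Shalf ** Shalf = S"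
    using assms by (auto simp: pos_def_def is_psd_sqrt_def pos_semidef_def)
  have invG: "invertible ?G"
    using assms by (intro invertible_pos_def pos_def_Rop)
  note residual = lyap_gain_residual[OF sym(1,2) invG assms(7)]
  obtain N where N: "(norm (matpow (?X Pstar) N))\<^sup>2 < 1 / 2"
    using closed_loop_power_small[OF assms(6,5) sym(3) assms(4)] residual[of "?K Pstar"] Shalf
    by auto
  obtain c d where c: "c > 0" and d: "d > 0" and lip:
    "\<And>P. norm (P - Pstar) < d \<Longrightarrow> invertible (Rop B R P) \<and> norm (?K P - ?K Pstar) \<le> c * norm (P - Pstar)"
    using gain_lipschitz[OF invG] by metis
  \<comment> \<open>\<open>M\<close> strictly exceeds the constant of \<open>norm_le_lyap\<close> at the optimum, hence bounds it nearby;
    \<open>C\<close> is then the constant of the quadratic error estimate.\<close>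
  define M where "M = 2 * (\<Sum>k<N. (norm (matpow (?X Pstar) k))\<^sup>2) + 1"
  define C where "C = M * (norm ?G * c\<^sup>2)"
  have "M > 0" unfolding M_def by (intro add_nonneg_pos mult_nonneg_nonneg sum_nonneg) simp_all
  then have C: "C \<ge> 0" by (simp add: C_def)
  have near: "\<forall>\<^sub>F P in nhds Pstar. norm (P - Pstar) < e" if "e > 0" for e
    using that by (auto simp: eventually_nhds_metric dist_norm)
  have "((\<lambda>P. ?K P - ?K Pstar) \<longlongrightarrow> 0) (nhds Pstar)"
  proof (rule Lim_null_comparison)
    show "\<forall>\<^sub>F P in nhds Pstar. norm (?K P - ?K Pstar) \<le> c * norm (P - Pstar)"
      using near[OF d] by eventually_elim (use lip in blast)
    have "((\<lambda>P. c * norm (P - Pstar)) \<longlongrightarrow> c * norm (Pstar - Pstar)) (nhds Pstar)"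
      by (intro tendsto_intros filterlim_ident)
    then show "((\<lambda>P. c * norm (P - Pstar)) \<longlongrightarrow> 0) (nhds Pstar)" by simp
  qed
  then have "(?K \<longlongrightarrow> ?K Pstar) (nhds Pstar)"
    by (rule LIM_zero_cancel)
  then have X: "(?X \<longlongrightarrow> ?X Pstar) (nhds Pstar)"
    unfolding closed_loop_def by (intro tendsto_intros matrix_mult.tendsto)
  have ev_N: "\<forall>\<^sub>F P in nhds Pstar. (norm (matpow (?X P) N))\<^sup>2 < 1 / 2"
    by (rule order_tendstoD(2)[OF _ N]) (intro tendsto_intros tendsto_matpow X)
  have ev_M: "\<forall>\<^sub>F P in nhds Pstar. 2 * (\<Sum>k<N. (norm (matpow (?X P) k))\<^sup>2) < M"
  proof (rule order_tendstoD(2))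
    show "((\<lambda>P. 2 * (\<Sum>k<N. (norm (matpow (?X P) k))\<^sup>2))
        \<longlongrightarrow> 2 * (\<Sum>k<N. (norm (matpow (?X Pstar) k))\<^sup>2)) (nhds Pstar)"
      by (intro tendsto_intros tendsto_matpow X)
  qed (simp add: M_def)
  have "\<sigma> / (C + 1) > 0" using assms(8) C by simp
  from ev_N ev_M near[OF d] near[OF this]
  have "\<forall>\<^sub>F P in nhds Pstar. invertible (Rop B R P) \<and> stable_mat (?X P) \<and>
      norm (policy_iterate A B S R P - Pstar) \<le> \<sigma> * norm (P - Pstar)"
  proof eventually_elim
    case (elim P)
    let ?D = "?K P - ?K Pstar" and ?p = "norm (P - Pstar)"
    have "norm (matpow (?X P) N) < 1"
      using elim(1) by (intro power_less_imp_less_base[of _ 2 1]) auto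
    then have stable: "stable_mat (?X P)" by (rule stable_mat_if_power_small)
    have "lyap (?X P) (policy_iterate A B S R P) = - S - transpose (?K P) ** R ** ?K P"
      unfolding policy_iterate_def Let_def using elim(1) by (intro lyap_inv[of _ N]) simp
    then have "lyap (?X P) (policy_iterate A B S R P - Pstar) = - (transpose ?D ** ?G ** ?D)"
      by (simp add: linear_diff[OF linear_lyap] residual)
    then have "norm (policy_iterate A B S R P - Pstar)
        \<le> 2 * (\<Sum>k<N. (norm (matpow (?X P) k))\<^sup>2) * norm (transpose ?D ** ?G ** ?D)"
      using norm_le_lyap[of "?X P" N "policy_iterate A B S R P - Pstar"] elim(1) by simp
    also have "\<dots> \<le> M * norm (transpose ?D ** ?G ** ?D)"
      using elim(2) by (intro mult_right_mono) auto
    also have "\<dots> \<le> M * ((norm ?D)\<^sup>2 * norm ?G)"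
      using \<open>M > 0\<close> by (intro mult_left_mono norm_congruence_le) simp
    also have "\<dots> \<le> M * ((c * ?p)\<^sup>2 * norm ?G)"
      using \<open>M > 0\<close> lip[OF elim(3)] by (intro mult_left_mono mult_right_mono power_mono) auto
    also have "\<dots> = C * ?p * ?p"
      by (simp add: C_def power2_eq_square)
    also have "\<dots> \<le> \<sigma> * ?p"
    proof (rule mult_right_mono)
      have "C * ?p \<le> (C + 1) * ?p" by (simp add: mult_right_mono)
      also have "\<dots> \<le> \<sigma>" using elim(4) C by (simp add: pos_less_divide_eq mult.commute)
      finally show "C * ?p \<le> \<sigma>" .
    qed simp
    finally show ?case using stable lip[OF elim(3)] by blast
  qed
  then show ?thesis
    by (auto simp: eventually_nhds_metric dist_norm)
qed

end
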